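(* Let $G$ be a locally pseudocompact group, with completion $\widetilde G$. Then $G$ is zero-dimensional if and only if $\widetilde G$ is zero-dimensional.
   Context: All topological spaces and topological groups are assumed to be Tychonoff (in particular Hausdorff); groups need not be abelian. A space is pseudocompact if every continuous real-valued function on it is bounded. A topological group $G$ is locally pseudocompact if there is an open neighborhood $U$ of the identity such that $\operatorname{cl}_G U$ is pseudocompact. Every locally pseudocompact group $G$ is locally precompact, i.e., it embeds as a dense topological subgroup of a locally compact group $\widetilde G$, unique up to topological isomorphism fixing $G$; $\widetilde G$ is called the completion of $G$. A space is zero-dimensional if it has a base consisting of clopen (open-and-closed) sets. *)

theory Defs
  imports "HOL-Analysis.Analysis" "HOL-Algebra.Group"
begin

definition tychonoff_space :: "'a topology \<Rightarrow> bool" where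
  "tychonoff_space X \<longleftrightarrow> completely_regular_space X \<and> Hausdorff_space X"

definition pseudocompact_space :: "'a topology \<Rightarrow> bool" where
  "pseudocompact_space X \<longleftrightarrow>
     (\<forall>f::'a \<Rightarrow> real. continuous_map X euclideanreal f \<longrightarrow> bounded (f ` topspace X))"

definition zero_dimensional_space :: "'a topology \<Rightarrow> bool" where
  "zero_dimensional_space X \<longleftrightarrow>
     (\<exists>\<B>. (\<forall>B\<in>\<B>. openin X B \<and> closedin X B) \<and>
          openin X = arbitrary union_of (\<lambda>U. U \<in> \<B>))"

text \<open>
  Topological groups are (not necessarily abelian) groups together with a topology on their carrier.
  As a standing convention they are Tychonoff.
\<close>
definition topological_group :: "('a, 'm) monoid_scheme \<Rightarrow> 'a topology \<Rightarrow> bool" where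
  "topological_group G T \<longleftrightarrow>
     group G \<and> topspace T = carrier G \<and>
     continuous_map (prod_topology T T) T (\<lambda>(x, y). x \<otimes>\<^bsub>G\<^esub> y) \<and>
     continuous_map T T (\<lambda>x. inv\<^bsub>G\<^esub> x) \<and>
     tychonoff_space T"

definition locally_pseudocompact_group :: "('a, 'm) monoid_scheme \<Rightarrow> 'a topology \<Rightarrow> bool" where
  "locally_pseudocompact_group G T \<longleftrightarrow>
     topological_group G T \<and>
     (\<exists>U. openin T U \<and> \<one>\<^bsub>G\<^esub> \<in> U \<and> pseudocompact_space (subtopology T (T closure_of U)))"

text \<open>
  The completion is only determined up to topological isomorphism fixing the dense subgroup, so it is
  given as a predicate: \<open>(C, S)\<close> is a locally compact group in which \<open>(G, T)\<close> is embedded by \<open>e\<close> as a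
  dense topological subgroup.
\<close>
definition is_completion ::
    "('a, 'm) monoid_scheme \<Rightarrow> 'a topology \<Rightarrow> ('b, 'n) monoid_scheme \<Rightarrow> 'b topology \<Rightarrow> ('a \<Rightarrow> 'b) \<Rightarrow> bool"
  where
  "is_completion G T C S e \<longleftrightarrow>
     topological_group C S \<and> locally_compact_space S \<and>
     e \<in> hom G C \<and> embedding_map T S e \<and> S closure_of (e ` carrier G) = carrier C"

end

theory Submission
  imports Defs
begin

text \<open>
  Zero-dimensionality passes from the completion to its subspace \<open>G\<close>. Conversely, the identity of \<open>G\<close> has
  arbitrarily small clopen neighbourhoods \<open>W\<close> inside a pseudocompact set; these are pseudocompact, and it
  suffices that the closure of \<open>W\<close> in the completion is open, i.e. disjoint from the closure of the
  complement of \<open>W\<close> in \<open>G\<close>. For a common point \<open>p\<close> of both closures, one builds a compact subgroup \<open>N\<close>, the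
  intersection of a sequence of open sets, such that \<open>pN\<close> lies in the second closure. By pseudocompactness
  \<open>W\<close> meets \<open>pN\<close>, which is absurd. This replaces the usual argument by uniform continuity or by
  metrizable quotients and needs no Haar measure.
\<close>

section \<open>Zero-dimensional spaces and embeddings\<close>

lemma zero_dimensional_spaceI:
  assumes "\<And>U x. openin X U \<Longrightarrow> x \<in> U \<Longrightarrow> \<exists>B. openin X B \<and> closedin X B \<and> x \<in> B \<and> B \<subseteq> U"
  shows "zero_dimensional_space X"
proof -
  have "openin X = arbitrary union_of (\<lambda>U. U \<in> {B. openin X B \<and> closedin X B})"
    unfolding openin_topology_base_unique using assms by simp
  then show ?thesis
    unfolding zero_dimensional_space_def
    by (intro exI[of _ "{B. openin X B \<and> closedin X B}"]) simp
qed

lemma zero_dimensional_spaceE: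
  assumes "zero_dimensional_space X" "openin X U" "x \<in> U"
  obtains B where "openin X B" "closedin X B" "x \<in> B" "B \<subseteq> U"
proof -
  obtain \<B> where \<B>: "\<forall>B\<in>\<B>. openin X B \<and> closedin X B"
    "openin X = arbitrary union_of (\<lambda>U. U \<in> \<B>)"
    using assms(1) by (auto simp: zero_dimensional_space_def)
  from \<B>(2) obtain B where "B \<in> \<B>" "x \<in> B" "B \<subseteq> U"
    unfolding openin_topology_base_unique using assms(2,3) by blast
  then show thesis using \<B>(1) by (intro that[of B]) auto
qed

lemma closure_of_meets:
  assumes "x \<in> X closure_of A" "openin X U" "x \<in> U"
  obtains y where "y \<in> A" "y \<in> U"
  using assms by (auto simp: in_closure_of)

text \<open>An open \<open>U\<close> is the trace of some open \<open>R\<close> of \<open>Y\<close>,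
  and a clopen set between \<open>f x\<close> and \<open>R\<close> has a clopen preimage.
  Injectivity of \<open>f\<close> keeps this preimage inside \<open>U\<close>.\<close>

lemma zero_dimensional_space_embedding:
  assumes Y: "zero_dimensional_space Y" and f: "embedding_map X Y f"
  shows "zero_dimensional_space X"
proof (rule zero_dimensional_spaceI)
  fix U x assume U: "openin X U" "x \<in> U"
  have hom: "homeomorphic_map X (subtopology Y (f ` topspace X)) f"
    using f by (simp add: embedding_map_def)
  have cont: "continuous_map X Y f"
    using homeomorphic_imp_continuous_map[OF hom] continuous_map_into_fulltopology by blast
  have inj: "inj_on f (topspace X)"
    using hom homeomorphic_imp_injective_map by blast
  have "openin (subtopology Y (f ` topspace X)) (f ` U)"
    using hom U homeomorphic_map_openness_eq by blast
  then obtain R where R: "openin Y R" "f ` U = R \<inter> f ` topspace X"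
    by (auto simp: openin_subtopology)
  with U have "f x \<in> R" by blast
  from zero_dimensional_spaceE[OF Y R(1) this]
  obtain B where B: "openin Y B" "closedin Y B" "f x \<in> B" "B \<subseteq> R" .
  define K where "K = {y \<in> topspace X. f y \<in> B}"
  have "openin X K" "closedin X K"
    unfolding K_def using cont B
    by (auto intro: openin_continuous_map_preimage closedin_continuous_map_preimage)
  moreover have "x \<in> K"
    using U B openin_subset by (fastforce simp: K_def)
  moreover have "K \<subseteq> U"
  proof
    fix y assume y: "y \<in> K"
    then have "f y \<in> f ` U"
      using R B by (auto simp: K_def)
    with inj y show "y \<in> U"
      using openin_subset[OF U(1)] by (auto simp: K_def inj_on_def)
  qed
  ultimately show "\<exists>B. openin X B \<and> closedin X B \<and> x \<in> B \<and> B \<subseteq> U" by blast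
qed

section \<open>Pseudocompactness and series of real functions\<close>

text \<open>A clopen set has empty frontier, so extension by zero is continuous. Closedness alone
  would not suffice: closed subspaces of pseudocompact spaces need not be pseudocompact.\<close>

lemma pseudocompact_space_clopen:
  assumes X: "pseudocompact_space X" and W: "openin X W" "closedin X W"
  shows "pseudocompact_space (subtopology X W)"
  unfolding pseudocompact_space_def
proof (intro allI impI)
  fix f :: "'a \<Rightarrow> real"
  assume f: "continuous_map (subtopology X W) euclideanreal f"
  have "continuous_map X euclideanreal (\<lambda>x. if x \<in> W then f x else 0)"
  proof (rule continuous_map_cases)
    show "continuous_map (subtopology X (X closure_of {x. x \<in> W})) euclideanreal f"
      using f W by (simp add: closure_of_closedin)
    show "\<And>x. x \<in> X frontier_of {x. x \<in> W} \<Longrightarrow> f x = 0"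
      using W by (simp add: frontier_of_eq_empty[THEN iffD2] closedin_subset)
  qed auto
  then have "bounded ((\<lambda>x. if x \<in> W then f x else 0) ` topspace X)"
    using X unfolding pseudocompact_space_def by blast
  moreover have "f ` topspace (subtopology X W) \<subseteq> (\<lambda>x. if x \<in> W then f x else 0) ` topspace X"
    by auto
  ultimately show "bounded (f ` topspace (subtopology X W))"
    using bounded_subset by blast
qed

lemma pseudocompact_space_continuous_image:
  assumes X: "pseudocompact_space X" and f: "continuous_map X Y f"
    and im: "f ` topspace X = topspace Y"
  shows "pseudocompact_space Y"
  unfolding pseudocompact_space_def
proof (intro allI impI)
  fix g :: "'b \<Rightarrow> real" assume "continuous_map Y euclideanreal g"
  then have "continuous_map X euclideanreal (g \<circ> f)"
    using f continuous_map_compose by blast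
  then have "bounded ((g \<circ> f) ` topspace X)"
    using X unfolding pseudocompact_space_def by blast
  then show "bounded (g ` topspace Y)"
    by (metis im image_comp)
qed

lemma continuous_map_suminf:
  fixes f :: "nat \<Rightarrow> 'a \<Rightarrow> real"
  assumes f: "\<And>n. continuous_map X euclideanreal (f n)"
    and M: "summable M" "\<And>n x. x \<in> topspace X \<Longrightarrow> norm (f n x) \<le> M n"
  shows "continuous_map X euclideanreal (\<lambda>x. \<Sum>n. f n x)"
proof -
  have lim: "uniform_limit (topspace X) (\<lambda>n x. \<Sum>i<n. f i x) (\<lambda>x. \<Sum>n. f n x) sequentially"
    using M by (intro Weierstrass_m_test) auto
  \<comment> \<open>The uniform limit theorem speaks of maps into a metric space, so the real line
    first appears as one.\<close>
  have "continuous_map X Met_TC.mtopology (\<lambda>x. \<Sum>n. f n x)"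
  proof (rule Met_TC.continuous_map_uniform_limit)
    show "\<forall>\<^sub>F n in sequentially. continuous_map X Met_TC.mtopology (\<lambda>x. \<Sum>i<n. f i x)"
      using f by (intro always_eventually allI) (simp add: continuous_map_sum)
    show "\<forall>\<^sub>F n in sequentially. \<forall>x\<in>topspace X. (\<Sum>n. f n x) \<in> UNIV \<and>
        dist (\<Sum>i<n. f i x) (\<Sum>n. f n x) < \<epsilon>" if "\<epsilon> > 0" for \<epsilon>
      using lim that by (simp add: uniform_limit_iff)
  qed auto
  then show ?thesis by simp
qed

text \<open>If the intersection missed \<open>W\<close>, a weighted sum of functions separating \<open>p\<close> from the
  complements of the \<open>U n\<close> would have an unbounded reciprocal on \<open>W\<close>.\<close>
lemma pseudocompact_meets_Inter:
  fixes U :: "nat \<Rightarrow> 'a set"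
  assumes X: "completely_regular_space X" and W: "pseudocompact_space (subtopology X W)"
    and p: "p \<in> X closure_of W" and U: "\<And>n. openin X (U n)" "\<And>n. p \<in> U n"
  shows "W \<inter> (\<Inter>n. U n) \<noteq> {}"
proof
  assume empty: "W \<inter> (\<Inter>n. U n) = {}"
  have "\<exists>f::'a \<Rightarrow> real. continuous_map X (top_of_set {0..1}) f \<and> f p = 0 \<and>
      f ` (topspace X - U n) \<subseteq> {1}" for n
  proof -
    have "closedin X (topspace X - U n)" "p \<in> topspace X - (topspace X - U n)"
      using U openin_subset[OF U(1)] by (auto intro: closedin_diff)
    with X show ?thesis unfolding completely_regular_space_def by blast
  qed
  then obtain f :: "nat \<Rightarrow> 'a \<Rightarrow> real" where
    f: "\<And>n. continuous_map X (top_of_set {0..1}) (f n)" and fp: "\<And>n. f n p = 0"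
    and f1: "\<And>n. f n ` (topspace X - U n) \<subseteq> {1}"
    by metis
  have cf: "continuous_map X euclideanreal (f n)" for n
    using f[of n] continuous_map_into_fulltopology by blast
  have f01: "0 \<le> f n x" "f n x \<le> 1" if "x \<in> topspace X" for n x
    using f[of n] that by (auto simp: continuous_map_in_subtopology)
  \<comment> \<open>Each \<open>f n\<close> takes values in [0, 1], so the geometric weights give
    uniform convergence and hence continuity. They are positive, so one \<open>n\<close> with
    \<open>f n x = 1\<close> makes \<open>h x\<close> positive.\<close>
  define h where "h = (\<lambda>x. \<Sum>n. (1/2)^n * f n x)"
  have le: "norm ((1/2)^n * f n x) \<le> (1/2)^n" if "x \<in> topspace X" for n x
    using f01[OF that, of n] by (simp add: abs_mult mult_left_le)
  have ch: "continuous_map X euclideanreal h"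
    unfolding h_def
    by (rule continuous_map_suminf[where M = "\<lambda>n. (1/2)^n"])
       (auto intro: continuous_map_real_mult_left cf le summable_geometric simp del: real_norm_def)
  have hp: "h p = 0"
    by (simp add: h_def fp)
  have pos: "h x > 0" if x: "x \<in> W" "x \<in> topspace X" for x
  proof -
    obtain n where "x \<notin> U n"
      using empty x by blast
    then have "f n x = 1"
      using f1[of n] x by blast
    moreover have "summable (\<lambda>n. (1/2)^n * f n x)"
      by (rule summable_comparison_test'[where N = 0 and g = "\<lambda>n. (1/2)^n"])
         (use le[OF x(2)] in auto)
    ultimately show ?thesis
      unfolding h_def using f01[OF x(2)] by (intro suminf_pos2[where i = n]) auto
  qed
  have "continuous_map (subtopology X W) euclideanreal (\<lambda>x. inverse (h x))"
    using pos by (intro continuous_map_real_inverse continuous_map_from_subtopology ch) force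
  then obtain b where b: "\<And>x. x \<in> W \<Longrightarrow> x \<in> topspace X \<Longrightarrow> \<bar>inverse (h x)\<bar> \<le> b"
    using W unfolding pseudocompact_space_def bounded_iff by fastforce
  \<comment> \<open>Where 0 < \<open>h x\<close> < \<open>c\<close>, the reciprocal exceeds
    \<open>\<bar>b\<bar> + 1\<close> and so breaks the bound \<open>b\<close>. The absolute value
    guarantees that \<open>c\<close> is positive, whence \<open>h < c\<close> near
    \<open>p\<close>.\<close>
  define c where "c = 1 / (\<bar>b\<bar> + 1)"
  have "openin X {x \<in> topspace X. h x \<in> {..<c}}"
    using ch by (rule openin_continuous_map_preimage) auto
  moreover have "p \<in> {x \<in> topspace X. h x \<in> {..<c}}"
    using hp p by (simp add: c_def in_closure_of)
  ultimately obtain x where "x \<in> W" "x \<in> {x \<in> topspace X. h x \<in> {..<c}}"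
    by (rule closure_of_meets[OF p])
  then have x: "x \<in> W" "x \<in> topspace X" "h x < c" by auto
  then have "inverse (h x) > \<bar>b\<bar> + 1"
    using pos[OF x(1,2)] by (simp add: c_def field_simps)
  with b[OF x(1,2)] show False by linarith
qed

section \<open>Topological groups and closures in locally compact groups\<close>

context
  fixes C :: "('b, 'n) monoid_scheme" (structure) and S :: "'b topology"
  assumes C: "topological_group C S"
begin

interpretation group C
  using C by (simp add: topological_group_def)

private lemma topspace_eq [simp]: "topspace S = carrier C"
  using C by (simp add: topological_group_def)

lemma continuous_map_group_mult:
  assumes "continuous_map X S f" "continuous_map X S g"
  shows "continuous_map X S (\<lambda>x. f x \<otimes> g x)"
proof -
  have "continuous_map X S ((\<lambda>(x, y). x \<otimes> y) \<circ> (\<lambda>x. (f x, g x)))"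
    using C assms
    by (intro continuous_map_compose[where X' = "prod_topology S S"])
       (auto simp: topological_group_def continuous_map_pairwise o_def)
  then show ?thesis by (simp add: o_def)
qed

lemma openin_left_translate:
  assumes "a \<in> carrier C" "openin S V"
  shows "openin S {x \<in> carrier C. a \<otimes> x \<in> V}"
proof -
  have "continuous_map S S (\<lambda>x. a \<otimes> x)"
    using assms by (auto intro!: continuous_map_group_mult)
  from openin_continuous_map_preimage[OF this assms(2)] show ?thesis by simp
qed

lemma closedin_left_translate:
  assumes "a \<in> carrier C" "closedin S V"
  shows "closedin S {x \<in> carrier C. a \<otimes> x \<in> V}"
proof -
  have "continuous_map S S (\<lambda>x. a \<otimes> x)"
    using assms by (auto intro!: continuous_map_group_mult)
  from closedin_continuous_map_preimage[OF this assms(2)] show ?thesis by simp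
qed

lemma openin_right_translate:
  assumes "a \<in> carrier C" "openin S V"
  shows "openin S {x \<in> carrier C. x \<otimes> a \<in> V}"
proof -
  have "continuous_map S S (\<lambda>x. x \<otimes> a)"
    using assms by (auto intro!: continuous_map_group_mult)
  from openin_continuous_map_preimage[OF this assms(2)] show ?thesis by simp
qed

lemma symmetric_neighbourhood_exists:
  assumes V: "openin S V" "\<one> \<in> V"
  obtains V' where "openin S V'" "\<one> \<in> V'" "V' \<subseteq> V" "\<And>x. x \<in> V' \<Longrightarrow> inv x \<in> V'"
    "\<And>x y. x \<in> V' \<Longrightarrow> y \<in> V' \<Longrightarrow> x \<otimes> y \<in> V"
proof -
  let ?M = "{z \<in> topspace (prod_topology S S). (case z of (x, y) \<Rightarrow> x \<otimes> y) \<in> V}"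
  have M: "openin (prod_topology S S) ?M"
    using C V by (intro openin_continuous_map_preimage) (auto simp: topological_group_def)
  have "(\<one>, \<one>) \<in> ?M"
    using V by auto
  from iffD1[OF openin_prod_topology_alt M, rule_format, OF this]
  obtain A B where AB: "openin S A" "openin S B" "\<one> \<in> A" "\<one> \<in> B" and sub: "A \<times> B \<subseteq> ?M"
    by (elim exE conjE) (rule that)
  \<comment> \<open>Lying in both \<open>A\<close> and \<open>B\<close> puts products of two
    elements into \<open>V\<close>; intersecting with the preimage under inversion then gives
    symmetry.\<close>
  define D where "D = A \<inter> B \<inter> V"
  define V' where "V' = D \<inter> {x \<in> carrier C. inv x \<in> D}"
  have D: "openin S D" "D \<subseteq> carrier C"
    using AB V openin_subset[of S D] by (auto simp: D_def)
  have "openin S {x \<in> topspace S. inv x \<in> D}"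
    using C D by (intro openin_continuous_map_preimage) (auto simp: topological_group_def)
  with D have "openin S V'" by (auto simp: V'_def)
  moreover have "\<one> \<in> V'" using AB V by (auto simp: V'_def D_def)
  moreover have "V' \<subseteq> V" by (auto simp: V'_def D_def)
  moreover have "inv x \<in> V'" if "x \<in> V'" for x using that by (auto simp: V'_def)
  moreover have "x \<otimes> y \<in> V" if "x \<in> V'" "y \<in> V'" for x y
    using that sub by (auto simp: V'_def D_def)
  ultimately show ?thesis using that by blast
qed

text \<open>The neighbourhoods \<open>V n\<close> shrink to the subgroup \<open>N\<close>, and the points \<open>y n \<in> p V n\<close> satisfy \<open>y n N \<subseteq> O2\<close>.
  For \<open>w \<in> W \<inter> p N\<close> the sequence \<open>u n = w\<^sup>-\<^sup>1 y n\<close> clusters at some \<open>v \<in> N\<close>, so the points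
  \<open>y n v\<^sup>-\<^sup>1 = w u n v\<^sup>-\<^sup>1\<close> of \<open>O2\<close> cluster at \<open>w\<close>, which has the neighbourhood \<open>O1\<close>.\<close>
lemma disjoint_closures_of_pseudocompact:
  assumes lc: "locally_compact_space S"
    and W: "pseudocompact_space (subtopology S W)"
    and O: "openin S O1" "openin S O2" "W \<subseteq> O1" "O1 \<inter> O2 = {}"
  shows "S closure_of W \<inter> S closure_of O2 = {}"
proof (rule ccontr)
  assume "\<not> ?thesis"
  then obtain p where p: "p \<in> S closure_of W" "p \<in> S closure_of O2" by blast
  then have pC: "p \<in> carrier C" by (simp add: in_closure_of)
  \<comment> \<open>This is the translate p V, written as a preimage so that it is open by
    continuity.\<close>
  define tr where "tr V = {x \<in> carrier C. inv p \<otimes> x \<in> V}" for V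
  have tr: "openin S (tr V)" if "openin S V" for V
    unfolding tr_def using that pC by (intro openin_left_translate) auto
  have ptr: "p \<in> tr V" if "\<one> \<in> V" for V
    using that pC by (simp add: tr_def)
  obtain V0 K where V0: "openin S V0" "compactin S K" "\<one> \<in> V0" "V0 \<subseteq> K"
    using lc unfolding locally_compact_space_def topspace_eq by (metis one_closed)
  \<comment> \<open>Staying inside \<open>V0\<close>, hence inside the compact \<open>K\<close>,
    later provides a cluster point.\<close>
  define good where "good V \<longleftrightarrow> openin S V \<and> \<one> \<in> V \<and> V \<subseteq> V0" for V
  \<comment> \<open>The point \<open>y\<close> is chosen along with \<open>V'\<close>, since how
    small \<open>V'\<close> must be depends on \<open>y\<close>.\<close>
  define step where "step V V' \<longleftrightarrow> V' \<subseteq> V \<and> (\<forall>x\<in>V'. inv x \<in> V') \<and> (\<forall>x\<in>V'. \<forall>y\<in>V'. x \<otimes> y \<in> V) \<and>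
     (\<exists>y. y \<in> tr V \<and> (\<forall>x\<in>V'. y \<otimes> x \<in> O2))" for V V'
  have "\<exists>V'. good V' \<and> step V V'" if "good V" for V
  proof -
    have V: "openin S V" "\<one> \<in> V" "V \<subseteq> V0" using that by (auto simp: good_def)
    obtain y where y: "y \<in> tr V" "y \<in> O2"
      using closure_of_meets[OF p(2) tr[OF V(1)] ptr[OF V(2)]] by metis
    have yC: "y \<in> carrier C" using y by (simp add: tr_def)
    \<comment> \<open>As \<open>y\<close> lies in the open \<open>O2\<close>, a whole neighbourhood
      of the identity is moved into \<open>O2\<close> by left multiplication with
      \<open>y\<close>.\<close>
    have "openin S (V \<inter> {x \<in> carrier C. y \<otimes> x \<in> O2})"
      using V O yC openin_left_translate by blast
    moreover have "\<one> \<in> V \<inter> {x \<in> carrier C. y \<otimes> x \<in> O2}"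
      using V y yC by simp
    ultimately obtain V' where V': "openin S V'" "\<one> \<in> V'" "V' \<subseteq> V \<inter> {x \<in> carrier C. y \<otimes> x \<in> O2}"
      "\<And>x. x \<in> V' \<Longrightarrow> inv x \<in> V'"
      "\<And>x z. x \<in> V' \<Longrightarrow> z \<in> V' \<Longrightarrow> x \<otimes> z \<in> V \<inter> {x \<in> carrier C. y \<otimes> x \<in> O2}"
      by (rule symmetric_neighbourhood_exists) blast
    then have "good V'" using V by (auto simp: good_def)
    moreover have "\<forall>x\<in>V'. y \<otimes> x \<in> O2" using V'(3) by blast
    then have "step V V'" using V' y(1) unfolding step_def by auto
    ultimately show ?thesis by blast
  qed
  moreover have "good V0" using V0 by (simp add: good_def)
  ultimately obtain V where good: "\<And>n. good (V n)" and step: "\<And>n. step (V n) (V (Suc n))"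
    using dependent_nat_choice[where P = "\<lambda>_. good" and Q = "\<lambda>_. step"] by metis
  have V: "openin S (V n)" "\<one> \<in> V n" "V n \<subseteq> V0" "V n \<subseteq> carrier C" for n
    using good[of n] openin_subset[of S "V n"] by (auto simp: good_def)
  have mono: "V (Suc n) \<subseteq> V n" and sym: "\<And>x. x \<in> V (Suc n) \<Longrightarrow> inv x \<in> V (Suc n)"
    and mult: "\<And>x y. x \<in> V (Suc n) \<Longrightarrow> y \<in> V (Suc n) \<Longrightarrow> x \<otimes> y \<in> V n" for n
    using step[of n] by (auto simp: step_def)
  have anti: "V n \<subseteq> V m" if "m \<le> n" for m n
    using lift_Suc_antimono_le[of V, OF mono that] .
  obtain y where y: "\<And>n. y n \<in> tr (V n)" "\<And>n x. x \<in> V (Suc n) \<Longrightarrow> y n \<otimes> x \<in> O2"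
  proof -
    have "\<forall>n. \<exists>z. z \<in> tr (V n) \<and> (\<forall>x\<in>V (Suc n). z \<otimes> x \<in> O2)"
      using step by (simp add: step_def)
    then show ?thesis using that by (metis (no_types))
  qed
  have yC: "y n \<in> carrier C" for n using y(1)[of n] by (simp add: tr_def)
  have "completely_regular_space S"
    using C unfolding topological_group_def tychonoff_space_def by blast
  then have "W \<inter> (\<Inter>n. tr (V n)) \<noteq> {}"
    using W p(1) by (rule pseudocompact_meets_Inter) (rule tr[OF V(1)] ptr[OF V(2)])+
  then obtain w where w: "w \<in> W" "\<And>n. w \<in> tr (V n)"
    by auto
  then have wC: "w \<in> carrier C" by (auto simp: tr_def)
  have wO: "w \<in> O1" using w O by blast
  define u where "u n = inv w \<otimes> y n" for n
  have uC: "u n \<in> carrier C" and wu: "w \<otimes> u n = y n" for n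
    using wC yC by (auto simp: u_def m_assoc[symmetric])
  \<comment> \<open>Both p^-1 w and p^-1 \<open>y (Suc n)\<close> lie in \<open>V (Suc n)\<close>;
    the quotient costs one index, as a product of two elements of \<open>V (Suc n)\<close> is only
    known to lie in \<open>V n\<close>.\<close>
  have uV: "u (Suc n) \<in> V n" for n
  proof -
    have "u (Suc n) = inv (inv p \<otimes> w) \<otimes> (inv p \<otimes> y (Suc n))"
      using wC pC yC by (simp add: u_def inv_mult_group m_assoc) (simp add: m_assoc[symmetric])
    then show ?thesis
      using mult sym w(2)[of "Suc n"] y(1)[of "Suc n"] by (simp add: tr_def)
  qed
  \<comment> \<open>The tail starts at \<open>Suc n\<close> because \<open>u k\<close> is known to
    lie in \<open>V n\<close> only for k > n.\<close>
  define F where "F n = S closure_of (u ` {Suc n..})" for n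
  have uVn: "u ` {Suc n..} \<subseteq> V n" for n
  proof (rule image_subsetI)
    fix k assume "k \<in> {Suc n..}"
    then obtain m where "k = Suc m" "n \<le> m"
      by (cases k) auto
    then show "u k \<in> V n" using uV[of m] anti[of n m] by blast
  qed
  \<comment> \<open>A single late term \<open>u m\<close> lies in all the finitely many sets;
    \<open>insert 0\<close> covers the case of empty \<open>I\<close>.\<close>
  have fin: "K \<inter> (\<Inter>n\<in>I. F n) \<noteq> {}" if "finite I" for I
  proof -
    define m where "m = Suc (Max (insert 0 I))"
    have "u m \<in> K"
      using uV[of "m - 1"] V(3)[of "m - 1"] V0(4) by (auto simp: m_def)
    moreover have "u m \<in> F i" if "i \<in> I" for i
    proof -
      have "Suc i \<le> m" using \<open>finite I\<close> that by (simp add: m_def)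
      then have "u m \<in> u ` {Suc i..}" by simp
      moreover have "u ` {Suc i..} \<subseteq> F i"
        unfolding F_def using uC by (intro closure_of_subset) auto
      ultimately show ?thesis by blast
    qed
    ultimately show ?thesis by blast
  qed
  have "K \<inter> \<Inter>(range F) \<noteq> {}"
    using V0(2) unfolding compactin_fip
  proof (elim conjE allE impE)
    show "(\<forall>A\<in>range F. closedin S A) \<and> (\<forall>\<F>. finite \<F> \<and> \<F> \<subseteq> range F \<longrightarrow> K \<inter> \<Inter>\<F> \<noteq> {})"
    proof (intro conjI allI impI ballI)
      show "closedin S A" if "A \<in> range F" for A
        using that by (auto simp: F_def)
      show "K \<inter> \<Inter>\<F> \<noteq> {}" if "finite \<F> \<and> \<F> \<subseteq> range F" for \<F>
        using that fin by (metis finite_subset_image)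
    qed
  qed
  then obtain v where v: "\<And>n. v \<in> F n" by blast
  then have vC: "v \<in> carrier C" by (auto simp: F_def in_closure_of)
  \<comment> \<open>\<open>V n\<close> need not be closed, so one index is spent: some
    \<open>x\<close> of the sequence in \<open>V (Suc n)\<close> is so close to \<open>v\<close>
    that v^-1 x also lies in \<open>V (Suc n)\<close>, and v is the quotient of the two.\<close>
  have vV: "v \<in> V n" for n
  proof -
    have "openin S {x \<in> carrier C. inv v \<otimes> x \<in> V (Suc n)}"
      using V vC by (intro openin_left_translate) auto
    moreover have "v \<in> {x \<in> carrier C. inv v \<otimes> x \<in> V (Suc n)}"
      using V vC by simp
    ultimately obtain x where "x \<in> u ` {Suc (Suc n)..}"
      "x \<in> {x \<in> carrier C. inv v \<otimes> x \<in> V (Suc n)}"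
      by (rule closure_of_meets[OF v[of "Suc n", unfolded F_def]])
    then have x: "x \<in> u ` {Suc (Suc n)..}" "x \<in> carrier C" "inv v \<otimes> x \<in> V (Suc n)" by auto
    then have "x \<in> V (Suc n)" using uVn by blast
    have "v = x \<otimes> inv (inv v \<otimes> x)"
      using x vC by (simp add: inv_mult_group m_assoc[symmetric])
    then show ?thesis
      using mult sym x(3) \<open>x \<in> V (Suc n)\<close> by metis
  qed
  \<comment> \<open>The map x -> w x v^-1 sends \<open>v\<close> to \<open>w\<close>, so
    \<open>A\<close> is a neighbourhood of the cluster point \<open>v\<close> and contains some
    \<open>u n\<close>.\<close>
  define A where "A = {x \<in> carrier C. w \<otimes> (x \<otimes> inv v) \<in> O1}"
  have "openin S {x \<in> carrier C. x \<otimes> inv v \<in> {z \<in> carrier C. w \<otimes> z \<in> O1}}"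
    by (intro openin_right_translate openin_left_translate inv_closed vC wC O(1))
  also have "{x \<in> carrier C. x \<otimes> inv v \<in> {z \<in> carrier C. w \<otimes> z \<in> O1}} = A"
    using vC by (auto simp: A_def)
  finally have "openin S A" .
  moreover have "v \<in> A" using vC wC wO by (simp add: A_def)
  ultimately obtain x where "x \<in> u ` {Suc 0..}" "x \<in> A"
    by (rule closure_of_meets[OF v[of 0, unfolded F_def]])
  then obtain n where n: "u n \<in> A" by blast
  have "w \<otimes> (u n \<otimes> inv v) = y n \<otimes> inv v"
    using wC vC uC wu by (simp add: m_assoc[symmetric])
  then have "y n \<otimes> inv v \<in> O1" using n by (simp add: A_def)
  moreover have "y n \<otimes> inv v \<in> O2" using y(2) sym vV by blast
  ultimately show False using O by blast
qed

text \<open>\<open>W\<close> is the trace on \<open>D\<close> of an open \<open>O1\<close> and of a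
  closed set with complement \<open>O2\<close>. The open set \<open>O1 \<inter> O2\<close> misses
  the dense \<open>D\<close>, so it is empty. The closures of \<open>W\<close> and \<open>O2\<close>
  are then disjoint and cover the group, so each is the complement of the other.\<close>

lemma closure_of_pseudocompact_clopen_in_dense:
  assumes lc: "locally_compact_space S" and dense: "S closure_of D = carrier C"
    and W: "openin (subtopology S D) W" "closedin (subtopology S D) W"
      "pseudocompact_space (subtopology S W)"
  shows "openin S (S closure_of W)"
proof -
  obtain O1 where O1: "openin S O1" "W = O1 \<inter> D"
    using W(1) by (auto simp: openin_subtopology)
  obtain Q where Q: "closedin S Q" "W = Q \<inter> D"
    using W(2) by (auto simp: closedin_subtopology)
  define O2 where "O2 = carrier C - Q"
  have O2: "openin S O2" using Q by (auto simp: O2_def closedin_def)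
  have "openin S (O1 \<inter> O2)" using O1 O2 by blast
  moreover have "O1 \<inter> O2 \<inter> D = {}" using O1 Q by (auto simp: O2_def)
  ultimately have disj: "O1 \<inter> O2 = {}"
    using dense openin_Int_closure_of_eq_empty[of S "O1 \<inter> O2" D] openin_subset[OF O2]
    by auto
  have cd: "S closure_of W \<inter> S closure_of O2 = {}"
    using disjoint_closures_of_pseudocompact[OF lc W(3) O1(1) O2 _ disj] O1 by blast
  \<comment> \<open>Points of \<open>D\<close> in \<open>Q\<close> belong to \<open>W\<close> and
    the others to \<open>O2\<close>, so the union is dense.\<close>
  have "carrier C = S closure_of (W \<union> O2)"
  proof -
    have "carrier C = S closure_of (carrier C \<inter> D)"
      using dense closure_of_restrict[of S D] by simp
    also have "\<dots> \<subseteq> S closure_of (W \<union> O2)"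
      using Q by (intro closure_of_mono) (auto simp: O2_def)
    finally show ?thesis using closure_of_subset_topspace[of S] by fastforce
  qed
  then have "S closure_of W = topspace S - S closure_of O2"
    using cd by (auto simp: closure_of_Un)
  then show ?thesis
    by (metis closedin_closure_of openin_diff openin_topspace)
qed

end

section \<open>Passing between the group and its completion\<close>

theorem theorem4p8:
  fixes G :: "('a, 'm) monoid_scheme" and T :: "'a topology"
    and C :: "('b, 'n) monoid_scheme" and S :: "'b topology"
    and e :: "'a \<Rightarrow> 'b"
  assumes "locally_pseudocompact_group G T"
    and "is_completion G T C S e"
  shows "zero_dimensional_space T \<longleftrightarrow> zero_dimensional_space S"
proof
  have emb: "embedding_map T S e" using assms by (simp add: is_completion_def)
  then show "zero_dimensional_space T" if "zero_dimensional_space S"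
    using that zero_dimensional_space_embedding by blast
  assume zT: "zero_dimensional_space T"
  have C: "topological_group C S" and lc: "locally_compact_space S" and hom: "e \<in> hom G C"
    and dense: "S closure_of (e ` carrier G) = carrier C"
    using assms by (auto simp: is_completion_def)
  have G: "topological_group G T" using assms by (simp add: locally_pseudocompact_group_def)
  interpret C: group C using C unfolding topological_group_def by (rule conjunct1)
  interpret G: group G using G unfolding topological_group_def by (rule conjunct1)
  have tT: "topspace T = carrier G" and tS: "topspace S = carrier C"
    using C G unfolding topological_group_def by blast+
  have e1: "e \<one>\<^bsub>G\<^esub> = \<one>\<^bsub>C\<^esub>"
    by (rule hom_one[OF hom G.is_group C.is_group])
  have eh: "homeomorphic_map T (subtopology S (e ` carrier G)) e"
    using emb by (simp add: embedding_map_def tT)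
  have ec: "continuous_map T S e"
    using homeomorphic_imp_continuous_map[OF eh] continuous_map_into_fulltopology by blast
  obtain U where U: "openin T U" "\<one>\<^bsub>G\<^esub> \<in> U" "pseudocompact_space (subtopology T (T closure_of U))"
    using assms by (auto simp: locally_pseudocompact_group_def)
  have reg: "regular_space S"
    using C unfolding topological_group_def tychonoff_space_def
    by (intro completely_regular_imp_regular_space) blast
  have at_one: "\<exists>K. openin S K \<and> closedin S K \<and> \<one>\<^bsub>C\<^esub> \<in> K \<and> K \<subseteq> Q"
    if Q: "openin S Q" "\<one>\<^bsub>C\<^esub> \<in> Q" for Q
  proof -
    obtain R P where R: "openin S R" "closedin S P" "\<one>\<^bsub>C\<^esub> \<in> R" "R \<subseteq> P" "P \<subseteq> Q"
      using reg Q unfolding neighbourhood_base_of_closedin[symmetric]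
      by (metis neighbourhood_base_of)
    have "openin T (U \<inter> {x \<in> topspace T. e x \<in> R})"
      using U R ec by (blast intro: openin_continuous_map_preimage)
    moreover have "\<one>\<^bsub>G\<^esub> \<in> U \<inter> {x \<in> topspace T. e x \<in> R}"
      using U R e1 by (simp add: tT)
    ultimately obtain W where W: "openin T W" "closedin T W" "\<one>\<^bsub>G\<^esub> \<in> W"
      and WU: "W \<subseteq> U \<inter> {x \<in> topspace T. e x \<in> R}"
      by (rule zero_dimensional_spaceE[OF zT])
    have Wcl: "W \<subseteq> T closure_of U"
      using WU closure_of_subset[OF openin_subset[OF U(1)]] by blast
    \<comment> \<open>\<open>W\<close> is clopen in \<open>T\<close> and contained in the
      pseudocompact closure of \<open>U\<close>, so it is clopen there.\<close>
    have "pseudocompact_space (subtopology (subtopology T (T closure_of U)) W)"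
      using W Wcl by (intro pseudocompact_space_clopen U(3))
        (auto simp: openin_subtopology closedin_subtopology)
    then have "pseudocompact_space (subtopology T W)"
      using Wcl by (simp add: subtopology_subtopology Int_absorb1)
    then have ps: "pseudocompact_space (subtopology S (e ` W))"
      using ec openin_subset[OF W(1)] continuous_map_image_subset_topspace[OF ec]
      by (elim pseudocompact_space_continuous_image[where f = e])
        (auto simp: continuous_map_in_subtopology continuous_map_from_subtopology)
    have "openin (subtopology S (e ` carrier G)) (e ` W)" "closedin (subtopology S (e ` carrier G)) (e ` W)"
      using eh W homeomorphic_map_openness_eq homeomorphic_map_closedness_eq by blast+
    then have "openin S (S closure_of (e ` W))"
      using closure_of_pseudocompact_clopen_in_dense[OF C lc dense] ps by blast
    moreover have "S closure_of (e ` W) \<subseteq> Q"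
      using WU R closure_of_minimal[of "e ` W" P S] by blast
    moreover have "\<one>\<^bsub>C\<^esub> \<in> S closure_of (e ` W)"
    proof -
      have "e ` W \<subseteq> topspace S"
        using openin_subset[OF W(1)] continuous_map_image_subset_topspace[OF ec] by blast
      then show ?thesis using closure_of_subset W(3) e1 by (metis imageI subsetD)
    qed
    ultimately show ?thesis by (intro exI[of _ "S closure_of (e ` W)"]) simp
  qed
  show "zero_dimensional_space S"
  proof (rule zero_dimensional_spaceI)
    fix Q x assume Q: "openin S Q" "x \<in> Q"
    then have x: "x \<in> carrier C" using openin_subset tS by blast
    have "openin S {z \<in> carrier C. x \<otimes>\<^bsub>C\<^esub> z \<in> Q}"
      using openin_left_translate[OF C x Q(1)] .
    then obtain K where K: "openin S K" "closedin S K" "\<one>\<^bsub>C\<^esub> \<in> K"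
      and KQ: "K \<subseteq> {z \<in> carrier C. x \<otimes>\<^bsub>C\<^esub> z \<in> Q}"
      using at_one Q x by fastforce
    \<comment> \<open>Homogeneity: the left translate x K of the clopen neighbourhood of the
      identity serves at \<open>x\<close>.\<close>
    define B where "B = {z \<in> carrier C. inv\<^bsub>C\<^esub> x \<otimes>\<^bsub>C\<^esub> z \<in> K}"
    have "openin S B" "closedin S B"
      unfolding B_def using x K C by (auto intro: openin_left_translate closedin_left_translate)
    moreover have "x \<in> B" using x K by (simp add: B_def)
    moreover have "B \<subseteq> Q"
    proof
      fix z assume z: "z \<in> B"
      then have "x \<otimes>\<^bsub>C\<^esub> (inv\<^bsub>C\<^esub> x \<otimes>\<^bsub>C\<^esub> z) \<in> Q" "z \<in> carrier C"
        using KQ by (auto simp: B_def)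
      then show "z \<in> Q" using x by (simp add: C.m_assoc[symmetric])
    qed
    ultimately show "\<exists>B. openin S B \<and> closedin S B \<and> x \<in> B \<and> B \<subseteq> Q" by blast
  qed
qed

end
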